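(* Let $\Gamma=(V,H)$ be an oriented hypergraph on $n$ vertices with no vertex of degree zero, let $m_V$ be the multiplicity of $0$ as an eigenvalue of its normalized Laplacian, $\lambda_{\min}$ the smallest nonzero eigenvalue and $\lambda_n$ the largest eigenvalue. Then $$\lambda_{\min}\le\frac{n}{n-m_V}\le\lambda_n,$$ and one of these two inequalities is an equality if and only if $\lambda_{\min}=\lambda_n$.
   Context: An oriented hypergraph is a pair $\Gamma=(V,H)$, $V$ finite with $n$ elements, each hyperedge $h\in H$ a pair $(h_{in},h_{out})$ of disjoint subsets of $V$; $h$ is identified with $h_{in}\cup h_{out}$. $\deg(i)$ is the number of hyperedges containing $i$. The normalized Laplacian acts on $f:V\to\mathbb{R}$ by $$Lf(i)=\frac{1}{\deg(i)}\Big[\sum_{h:\,i\in h_{in}}\Big(\sum_{i'\in h_{in}}f(i')-\sum_{j'\in h_{out}}f(j')\Big)-\sum_{h:\,i\in h_{out}}\Big(\sum_{i'\in h_{in}}f(i')-\sum_{j'\in h_{out}}f(j')\Big)\Big];$$ its eigenvalues are real and nonnegative, listed with multiplicity. *)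

theory Defs
  imports "HOL-Analysis.Analysis"
begin

text \<open>The vertex set of a hypergraph is a finite type, so that \<^term>\<open>CARD('v)\<close> is the number of
  vertices and a function on the vertices is a vector of type \<^typ>\<open>real ^ 'v\<close>.
  A hyperedge is the pair of its set of inputs and its set of outputs.\<close>

type_synonym 'v hyperedge = "'v set \<times> 'v set"

definition oriented_hypergraph :: "('v::finite) hyperedge set \<Rightarrow> bool" where
  "oriented_hypergraph H \<longleftrightarrow> (\<forall>(h_in, h_out)\<in>H. h_in \<inter> h_out = {})"

definition vertex_degree :: "('v::finite) hyperedge set \<Rightarrow> 'v \<Rightarrow> nat" where
  "vertex_degree H i = card {h \<in> H. i \<in> fst h \<union> snd h}"

definition normalized_laplacian :: "('v::finite) hyperedge set \<Rightarrow> real ^ 'v \<Rightarrow> real ^ 'v" where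
  "normalized_laplacian H f =
    (\<chi> i. 1 / real (vertex_degree H i) *
      ((\<Sum>h\<in>{h \<in> H. i \<in> fst h}. (\<Sum>i'\<in>fst h. f $ i') - (\<Sum>j'\<in>snd h. f $ j'))
     - (\<Sum>h\<in>{h \<in> H. i \<in> snd h}. (\<Sum>i'\<in>fst h. f $ i') - (\<Sum>j'\<in>snd h. f $ j'))))"

definition eigenspace :: "('a::euclidean_space \<Rightarrow> 'a) \<Rightarrow> real \<Rightarrow> 'a set" where
  "eigenspace T \<mu> = {x. T x = \<mu> *\<^sub>R x}"

definition eigenvalues :: "('a::euclidean_space \<Rightarrow> 'a) \<Rightarrow> real set" where
  "eigenvalues T = {\<mu>. \<exists>x. x \<noteq> 0 \<and> T x = \<mu> *\<^sub>R x}"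

text \<open>The normalized Laplacian is self-adjoint for the inner product weighted by the degrees, so
  the multiplicity of an eigenvalue can be taken to be the dimension of its eigenspace.\<close>

definition eigenvalue_multiplicity :: "('a::euclidean_space \<Rightarrow> 'a) \<Rightarrow> real \<Rightarrow> nat" where
  "eigenvalue_multiplicity T \<mu> = dim (eigenspace T \<mu>)"

definition smallest_nonzero_eigenvalue :: "('a::euclidean_space \<Rightarrow> 'a) \<Rightarrow> real" where
  "smallest_nonzero_eigenvalue T = Min (eigenvalues T - {0})"

definition largest_eigenvalue :: "('a::euclidean_space \<Rightarrow> 'a) \<Rightarrow> real" where
  "largest_eigenvalue T = Max (eigenvalues T)"

end

theory Submission
  imports Defs
begin

text \<open>Conjugating the normalized Laplacian by the square roots of the degrees gives a self-adjoint
  operator with the same eigenvalues and multiplicities. Its trace is \<open>n\<close>, because a vertex occurs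
  in a hyperedge only as an input or only as an output, so every diagonal entry is \<open>1\<close>. Hence
  \<open>n / (n - m\<^sub>V)\<close> is the average of the nonzero eigenvalues, and an average equals the minimum or
  the maximum only if all the averaged values agree.\<close>

section \<open>Spectral theorem for self-adjoint operators\<close>

text \<open>A maximizer \<open>u\<close> of the quadratic form on the unit sphere is an eigenvector: the form
  \<open>\<mu> x \<bullet> y - x \<bullet> T y\<close> is positive semidefinite and vanishes at \<open>u\<close>, so \<open>u\<close> is in its radical.\<close>

lemma self_adjoint_eigenvector_in_subspace:
  fixes T :: "'a::euclidean_space \<Rightarrow> 'a"
  assumes lin: "linear T" and sym: "\<And>x y. x \<bullet> T y = T x \<bullet> y"
    and U: "subspace U" and inv: "\<And>x. x \<in> U \<Longrightarrow> T x \<in> U" and "U \<noteq> {0}"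
  obtains u \<mu> where "u \<in> U" "norm u = 1" "T u = \<mu> *\<^sub>R u"
proof -
  interpret linear T by (rule lin)
  have "compact (sphere 0 1 \<inter> U)"
    by (intro compact_Int_closed closed_subspace U) auto
  moreover obtain v where "v \<in> U" "v \<noteq> 0"
    using U \<open>U \<noteq> {0}\<close> subspace_0 by blast
  then have "v /\<^sub>R norm v \<in> sphere 0 1 \<inter> U"
    using U by (simp add: subspace_scale)
  then have "sphere 0 1 \<inter> U \<noteq> {}" by blast
  moreover have "continuous_on (sphere 0 1 \<inter> U) (\<lambda>x. x \<bullet> T x)"
    by (intro continuous_intros linear_continuous_on) (simp add: lin linear_conv_bounded_linear[symmetric])
  ultimately obtain u where u: "u \<in> sphere 0 1 \<inter> U"
    and umax: "\<And>x. x \<in> sphere 0 1 \<inter> U \<Longrightarrow> x \<bullet> T x \<le> u \<bullet> T u"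
    using continuous_attains_sup by metis
  define \<mu> where "\<mu> = u \<bullet> T u"
  have uu: "u \<bullet> u = 1" using u by (simp add: dot_square_norm)
  \<comment> \<open>Both terms are homogeneous of degree 2, so maximality on the unit sphere extends
    to all of \<open>U\<close>.\<close>
  have psd: "0 \<le> \<mu> * (x \<bullet> x) - x \<bullet> T x" if "x \<in> U" for x
  proof (cases "x = 0")
    case False
    have "x /\<^sub>R norm x \<in> sphere 0 1 \<inter> U"
      using U that False by (simp add: subspace_scale)
    from umax[OF this] have "(x \<bullet> T x) / (norm x)\<^sup>2 \<le> \<mu>"
      by (simp add: scale \<mu>_def power2_eq_square divide_inverse mult_ac)
    then show ?thesis
      using False by (simp add: divide_le_eq dot_square_norm)
  qed (simp add: zero)
  \<comment> \<open>The residual \<open>w\<close>, to be shown zero, also serves as the direction in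
    which \<open>u\<close> is perturbed.\<close>
  define w where "w = T u - \<mu> *\<^sub>R u"
  have "w \<in> U" unfolding w_def using u U inv by (simp add: subspace_diff subspace_scale)
  have uTw: "u \<bullet> T w = w \<bullet> T u" by (metis sym inner_commute)
  have ww: "w \<bullet> T u - \<mu> * (u \<bullet> w) = w \<bullet> w"
  proof -
    have "w \<bullet> w = w \<bullet> (T u - \<mu> *\<^sub>R u)" by (simp only: w_def)
    then show ?thesis by (simp add: inner_diff_right inner_commute[of w u])
  qed
  define c where "c = \<mu> * (w \<bullet> w) - w \<bullet> T w"
  \<comment> \<open>Evaluate \<open>psd\<close> at \<open>u + t *\<^sub>R w\<close>: the constant
    term vanishes by the choice of \<open>\<mu>\<close>, and by \<open>ww\<close> the linear term is
    \<open>- 2 * t * (w \<bullet> w)\<close>.\<close>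
  have quad: "2 * t * (w \<bullet> w) \<le> t\<^sup>2 * c" for t
  proof -
    have "u + t *\<^sub>R w \<in> U" using u U \<open>w \<in> U\<close> by (simp add: subspace_add subspace_scale)
    from psd[OF this] have "0 \<le> t\<^sup>2 * c - 2 * t * (w \<bullet> T u - \<mu> * (u \<bullet> w))"
      by (simp add: add scale inner_add_left inner_add_right inner_commute[of w u] uu uTw c_def
          \<mu>_def[symmetric] power2_eq_square algebra_simps)
    then show ?thesis by (simp add: ww)
  qed
  \<comment> \<open>Divide \<open>quad\<close> by \<open>2 * t\<close> for positive \<open>t\<close>
    and let \<open>t\<close> tend to 0.\<close>
  have "w \<bullet> w \<le> 0"
  proof -
    have lim: "w \<bullet> w \<le> s * c / 2" if "s > 0" for s
      using quad[of s] that by (simp add: power2_eq_square)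
    have "((\<lambda>s. s * c / 2) \<longlongrightarrow> 0) (at_right 0)"
      by (auto intro!: tendsto_eq_intros)
    then show ?thesis
      by (rule tendsto_lowerbound) (use lim in \<open>simp_all add: eventually_mono[OF eventually_at_right_less]\<close>)
  qed
  then have "w = 0" by (metis inner_gt_zero_iff not_less)
  then show thesis using that[of u \<mu>] u by (simp add: w_def)
qed

text \<open>Split off a unit eigenvector \<open>u\<close>; self-adjointness makes its orthogonal
  complement in \<open>U\<close> invariant again, of smaller dimension. Allowing any invariant
  subspace lets the induction on the dimension restrict \<open>T\<close>.\<close>

lemma self_adjoint_eigenbasis_of_subspace:
  fixes T :: "'a::euclidean_space \<Rightarrow> 'a"
  assumes lin: "linear T" and sym: "\<And>x y. x \<bullet> T y = T x \<bullet> y"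
    and "subspace U" and "\<And>x. x \<in> U \<Longrightarrow> T x \<in> U"
  shows "\<exists>B. pairwise orthogonal B \<and> (\<forall>b\<in>B. norm b = 1 \<and> (\<exists>\<mu>. T b = \<mu> *\<^sub>R b)) \<and> span B = U"
  using assms(3,4)
proof (induction "dim U" arbitrary: U rule: less_induct)
  case less
  show ?case
  proof (cases "U = {0}")
    case True
    then show ?thesis by (intro exI[of _ "{}"]) auto
  next
    case False
    obtain u \<mu> where u: "u \<in> U" "norm u = 1" "T u = \<mu> *\<^sub>R u"
      using self_adjoint_eigenvector_in_subspace[OF lin sym less.prems False] by metis
    define W where "W = {x \<in> U. u \<bullet> x = 0}"
    have uu: "u \<bullet> u = 1" using u by (simp add: dot_square_norm)
    have "subspace W"
      using less.prems(1) unfolding W_def subspace_def by (auto simp: inner_add_right)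
    moreover have "T x \<in> W" if "x \<in> W" for x
      using that less.prems(2) u by (simp add: W_def sym)
    moreover have "dim W < dim U"
    proof -
      have "W \<subset> U" using u uu unfolding W_def by force
      moreover have "dim W \<noteq> dim U"
        using subspace_dim_equal[OF \<open>subspace W\<close> less.prems(1)] \<open>W \<subset> U\<close> by auto
      ultimately show ?thesis using dim_subset[of W U] by auto
    qed
    ultimately obtain B where B: "pairwise orthogonal B"
        "\<forall>b\<in>B. norm b = 1 \<and> (\<exists>\<mu>. T b = \<mu> *\<^sub>R b)" "span B = W"
      using less.hyps[of W] by blast
    have perp: "u \<bullet> b = 0" if "b \<in> B" for b
      using that B(3) span_base W_def by blast
    have "span (insert u B) = U"
    proof
      have "insert u B \<subseteq> U" using u B(3) span_superset[of B] W_def by auto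
      then show "span (insert u B) \<subseteq> U" using less.prems(1) span_minimal by blast
      show "U \<subseteq> span (insert u B)"
      proof
        fix x assume "x \<in> U"
        then have "x - (u \<bullet> x) *\<^sub>R u \<in> W"
          using less.prems(1) u uu
          by (simp add: W_def subspace_diff subspace_scale inner_diff_right)
        then show "x \<in> span (insert u B)"
          using B(3) span_breakdown_eq by blast
      qed
    qed
    moreover have "pairwise orthogonal (insert u B)"
      using B(1) perp by (auto simp: pairwise_insert orthogonal_def inner_commute)
    ultimately show ?thesis using B(2) u by (intro exI[of _ "insert u B"]) auto
  qed
qed

lemma self_adjoint_orthonormal_eigenbasis:
  fixes T :: "'a::euclidean_space \<Rightarrow> 'a"
  assumes lin: "linear T" and sym: "\<And>x y. x \<bullet> T y = T x \<bullet> y"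
  obtains B where "finite B" "pairwise orthogonal B" "\<And>b. b \<in> B \<Longrightarrow> norm b = 1"
    "\<And>b. b \<in> B \<Longrightarrow> T b = (b \<bullet> T b) *\<^sub>R b" "span B = UNIV" "independent B"
proof -
  obtain B where B: "pairwise orthogonal B"
      "\<forall>b\<in>B. norm b = 1 \<and> (\<exists>\<mu>. T b = \<mu> *\<^sub>R b)" "span B = UNIV"
    using self_adjoint_eigenbasis_of_subspace[OF lin sym, of UNIV] by auto
  have "T b = (b \<bullet> T b) *\<^sub>R b" if b: "b \<in> B" for b
  proof -
    obtain \<mu> where "T b = \<mu> *\<^sub>R b" using B(2) b by blast
    moreover have "b \<bullet> b = 1" using B(2) b by (simp add: dot_square_norm)
    ultimately show ?thesis by simp
  qed
  moreover have "0 \<notin> B" using B(2) by force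
  then have "independent B" using pairwise_orthogonal_independent B(1) by blast
  ultimately show thesis
    using that[of B] B pairwise_orthogonal_imp_finite by blast
qed

section \<open>The average of the nonzero eigenvalues\<close>

text \<open>In an orthonormal eigenbasis the trace is the sum of the eigenvalues. Zeros add nothing
  to it, and the divisor counts the nonzero ones, so \<open>avg\<close> is their mean.\<close>

lemma self_adjoint_average_nonzero_eigenvalue:
  fixes T :: "'a::euclidean_space \<Rightarrow> 'a" and tr :: real
  assumes lin: "linear T" and sym: "\<And>x y. x \<bullet> T y = T x \<bullet> y"
    and tr_def: "tr = (\<Sum>i\<in>Basis. i \<bullet> T i)" and "tr > 0"
  defines "lmin \<equiv> smallest_nonzero_eigenvalue T" and "lmax \<equiv> largest_eigenvalue T"
    and "avg \<equiv> tr / (real DIM('a) - real (eigenvalue_multiplicity T 0))"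
  shows "lmin \<le> avg \<and> avg \<le> lmax \<and> (lmin = avg \<or> avg = lmax \<longleftrightarrow> lmin = lmax)"
proof -
  interpret linear T by (rule lin)
  obtain B where B: "finite B" "pairwise orthogonal B" "\<And>b. b \<in> B \<Longrightarrow> norm b = 1"
      "\<And>b. b \<in> B \<Longrightarrow> T b = (b \<bullet> T b) *\<^sub>R b" "span B = UNIV" "independent B"
    using self_adjoint_orthonormal_eigenbasis[OF lin sym] by metis
  define ev where "ev = (\<lambda>b. b \<bullet> T b)"
  have ev: "T b = ev b *\<^sub>R b" if "b \<in> B" for b
    using B(4)[OF that] by (simp add: ev_def)
  have expand: "(\<Sum>b\<in>B. (x \<bullet> b) *\<^sub>R b) = x" for x
    by (rule orthonormal_basis_expand) (use B in auto)
  \<comment> \<open>Eigenvectors for distinct eigenvalues are orthogonal. This shows both that every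
    eigenvalue occurs on \<open>B\<close> and that the kernel is spanned by part of
    \<open>B\<close>.\<close>
  have coeff: "x \<bullet> b = 0" if "T x = \<mu> *\<^sub>R x" "b \<in> B" "ev b \<noteq> \<mu>" for x b \<mu>
  proof -
    have "\<mu> * (x \<bullet> b) = ev b * (x \<bullet> b)"
      using sym[of x b] that(1) ev[OF that(2)] by auto
    then show ?thesis using that(3) by auto
  qed
  have eigs: "eigenvalues T = ev ` B"
  proof
    show "eigenvalues T \<subseteq> ev ` B"
    proof
      fix \<mu> assume "\<mu> \<in> eigenvalues T"
      then obtain x where x: "x \<noteq> 0" "T x = \<mu> *\<^sub>R x" by (auto simp: eigenvalues_def)
      show "\<mu> \<in> ev ` B"
      proof (rule ccontr)
        assume "\<mu> \<notin> ev ` B"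
        then have "\<forall>b\<in>B. x \<bullet> b = 0" using coeff[OF x(2)] by blast
        then show False using expand[of x] x(1) by simp
      qed
    qed
    show "ev ` B \<subseteq> eigenvalues T"
    proof
      fix \<mu> assume "\<mu> \<in> ev ` B"
      then obtain b where b: "b \<in> B" "\<mu> = ev b" by blast
      then have "b \<noteq> 0" "T b = \<mu> *\<^sub>R b" using B(3)[of b] ev[of b] by auto
      then show "\<mu> \<in> eigenvalues T" unfolding eigenvalues_def by blast
    qed
  qed
  have "eigenspace T 0 = span {b \<in> B. ev b = 0}"
  proof
    show "eigenspace T 0 \<subseteq> span {b \<in> B. ev b = 0}"
    proof
      fix x assume "x \<in> eigenspace T 0"
      then have "x \<bullet> b = 0" if "b \<in> B" "ev b \<noteq> 0" for b
        using coeff[of x 0] that by (simp add: eigenspace_def)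
      then have "x = (\<Sum>b\<in>{b \<in> B. ev b = 0}. (x \<bullet> b) *\<^sub>R b)"
        by (subst expand[of x, symmetric], intro sum.mono_neutral_right) (use B in auto)
      then show "x \<in> span {b \<in> B. ev b = 0}"
        by (metis (no_types, lifting) span_base span_scale span_sum)
    qed
    have "subspace (eigenspace T 0)"
      by (auto simp: eigenspace_def subspace_def add scale)
    then show "span {b \<in> B. ev b = 0} \<subseteq> eigenspace T 0"
      using ev by (intro span_minimal) (auto simp: eigenspace_def)
  qed
  then have mult: "eigenvalue_multiplicity T 0 = card {b \<in> B. ev b = 0}"
    unfolding eigenvalue_multiplicity_def
    using B(6) by (simp add: dim_eq_card_independent independent_mono)
  have cardB: "card B = DIM('a)"
    using B(5,6) by (metis dim_eq_card_independent dim_span dim_UNIV)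
  \<comment> \<open>\<open>C\<close> indexes the nonzero eigenvalues with multiplicity.\<close>
  define C where "C = {b \<in> B. ev b \<noteq> 0}"
  have "finite C" using B(1) C_def by simp
  have "B = {b \<in> B. ev b = 0} \<union> C" "{b \<in> B. ev b = 0} \<inter> C = {}" by (auto simp: C_def)
  then have "card B = card {b \<in> B. ev b = 0} + card C"
    using card_Un_disjoint[of "{b \<in> B. ev b = 0}" C] B(1) \<open>finite C\<close> by simp
  then have cardC: "real DIM('a) - real (eigenvalue_multiplicity T 0) = real (card C)"
    using mult cardB by simp
  \<comment> \<open>The trace is moved to the eigenbasis: expand \<open>i\<close> in
    \<open>B\<close>, swap the sums, and collect the sum over \<open>Basis\<close> into
    \<open>b \<bullet> T b\<close>.\<close>
  have "tr = (\<Sum>i\<in>Basis. \<Sum>b\<in>B. (i \<bullet> b) * (i \<bullet> T b))"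
    unfolding tr_def
  proof (rule sum.cong[OF refl])
    fix i :: 'a
    have "T i = (\<Sum>b\<in>B. (i \<bullet> b) *\<^sub>R T b)"
      by (subst expand[of i, symmetric]) (simp add: sum scale)
    then show "i \<bullet> T i = (\<Sum>b\<in>B. (i \<bullet> b) * (i \<bullet> T b))"
      by (simp add: inner_sum_right)
  qed
  also have "\<dots> = (\<Sum>b\<in>B. \<Sum>i\<in>Basis. (i \<bullet> b) * (i \<bullet> T b))" by (rule sum.swap)
  also have "\<dots> = (\<Sum>b\<in>B. ev b)"
    unfolding ev_def by (subst (2) euclidean_inner) (simp add: inner_commute)
  also have "\<dots> = (\<Sum>b\<in>C. ev b)"
    unfolding C_def by (rule sum.mono_neutral_right) (use B(1) in auto)
  finally have tr: "tr = (\<Sum>b\<in>C. ev b)" .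
  \<comment> \<open>A positive trace forces some eigenvalue to be nonzero, so the divisor in
    \<open>avg\<close> is not 0.\<close>
  have "C \<noteq> {}" using tr \<open>tr > 0\<close> by auto
  then have "card C > 0" using \<open>finite C\<close> by (simp add: card_gt_0_iff)
  have avg: "avg = tr / card C" by (simp add: avg_def cardC)
  have "avg > 0" using avg \<open>tr > 0\<close> \<open>card C > 0\<close> by simp
  \<comment> \<open>Deviations from a mean sum to 0, so they cannot all be positive or all negative,
    and if all have one weak sign they vanish. The bounds and the equality cases follow from
    this.\<close>
  have deviation: "(\<Sum>b\<in>C. ev b - avg) = 0"
    using \<open>card C > 0\<close> by (simp add: sum_subtractf tr[symmetric] avg)
  have nonzero: "eigenvalues T - {0} = ev ` C" by (auto simp: eigs C_def)
  have lmin: "lmin = Min (ev ` C)"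
    by (simp add: lmin_def smallest_nonzero_eigenvalue_def nonzero)
  have lmax: "lmax = Max (ev ` B)"
    by (simp add: lmax_def largest_eigenvalue_def eigs)
  have min_le: "lmin \<le> ev b" if "b \<in> C" for b using that \<open>finite C\<close> by (simp add: lmin)
  have le_max: "ev b \<le> lmax" if "b \<in> B" for b using that B(1) by (simp add: lmax)
  have "C \<subseteq> B" by (auto simp: C_def)
  have lmin_le: "lmin \<le> avg"
  proof (rule ccontr)
    assume "\<not> lmin \<le> avg"
    then have "(\<Sum>b\<in>C. ev b - avg) > 0"
      using min_le by (intro sum_pos \<open>finite C\<close> \<open>C \<noteq> {}\<close>) force
    then show False using deviation by simp
  qed
  have le_lmax: "avg \<le> lmax"
  proof (rule ccontr)
    assume "\<not> avg \<le> lmax"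
    then have "(\<Sum>b\<in>C. avg - ev b) > 0"
      using le_max \<open>C \<subseteq> B\<close> by (intro sum_pos \<open>finite C\<close> \<open>C \<noteq> {}\<close>) force
    then show False using deviation by (simp add: sum_subtractf)
  qed
  have all_eq: "lmin = lmax" if eq: "\<forall>b\<in>C. ev b = avg"
  proof -
    have "ev ` C = {avg}" using eq \<open>C \<noteq> {}\<close> by auto
    \<comment> \<open>The largest eigenvalue is taken over all of \<open>B\<close>, so a possible
      eigenvalue 0 must be bounded too; \<open>avg > 0\<close> does this.\<close>
    moreover have "ev b \<le> avg" if "b \<in> B" for b
      using eq that \<open>avg > 0\<close> by (cases "ev b = 0") (auto simp: C_def)
    then have "lmax \<le> avg"
      unfolding lmax using B(1) \<open>C \<noteq> {}\<close> \<open>C \<subseteq> B\<close> by (subst Max_le_iff) auto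
    ultimately show ?thesis using lmin le_lmax by simp
  qed
  have "lmin = lmax" if "lmin = avg"
  proof (rule all_eq)
    have "\<forall>b\<in>C. ev b - avg = 0"
      using deviation min_le that by (subst sum_nonneg_eq_0_iff[symmetric]) (auto simp: \<open>finite C\<close>)
    then show "\<forall>b\<in>C. ev b = avg" by simp
  qed
  moreover have "lmin = lmax" if "avg = lmax"
  proof (rule all_eq)
    have "(\<Sum>b\<in>C. avg - ev b) = 0" using deviation by (simp add: sum_subtractf)
    then have "\<forall>b\<in>C. avg - ev b = 0"
      using le_max that \<open>C \<subseteq> B\<close> by (subst sum_nonneg_eq_0_iff[symmetric]) (auto simp: \<open>finite C\<close>)
    then show "\<forall>b\<in>C. ev b = avg" by simp
  qed
  \<comment> \<open>Conversely, if \<open>lmin = lmax\<close>, then \<open>avg\<close> is squeezed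
    between them.\<close>
  ultimately show ?thesis using lmin_le le_lmax by auto
qed

text \<open>An injective endomorphism in finite dimension is bijective, so \<open>P\<close> carries
  each eigenspace of \<open>T\<close> onto that of \<open>S\<close>.\<close>

lemma eigenvalues_conjugate:
  fixes P S T :: "'a::euclidean_space \<Rightarrow> 'a"
  assumes "linear P" "inj P" and "\<And>x. S (P x) = P (T x)"
  shows "eigenvalues S = eigenvalues T"
    and "eigenvalue_multiplicity S \<mu> = eigenvalue_multiplicity T \<mu>"
proof -
  interpret linear P by fact
  have surj: "surj P" using linear_injective_imp_surjective assms(1,2) by blast
  have iff: "S (P x) = \<nu> *\<^sub>R P x \<longleftrightarrow> T x = \<nu> *\<^sub>R x" for x \<nu>
    using assms(2,3) by (simp add: scale[symmetric] inj_eq)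
  have P0: "P x = 0 \<longleftrightarrow> x = 0" for x using assms(2) zero by (metis injD)
  have "(\<exists>y. y \<noteq> 0 \<and> S y = \<nu> *\<^sub>R y) \<longleftrightarrow> (\<exists>x. P x \<noteq> 0 \<and> S (P x) = \<nu> *\<^sub>R P x)" for \<nu>
    using surj by (metis surjD)
  then show "eigenvalues S = eigenvalues T"
    by (simp add: eigenvalues_def iff P0)
  have "eigenspace S \<mu> = P ` {x. S (P x) = \<mu> *\<^sub>R P x}"
    unfolding eigenspace_def using surj by (auto elim: surjE)
  then have "eigenspace S \<mu> = P ` eigenspace T \<mu>"
    by (simp add: iff eigenspace_def)
  then show "eigenvalue_multiplicity S \<mu> = eigenvalue_multiplicity T \<mu>"
    unfolding eigenvalue_multiplicity_def
    using dim_image_eq[OF assms(1) inj_on_subset[OF assms(2)]] by simp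
qed

section \<open>The symmetrized Laplacian\<close>

text \<open>The entries of the signed incidence matrix. They merge the separate sums over inputs and
  outputs in the Laplacian.\<close>

definition incidence :: "'v hyperedge \<Rightarrow> 'v \<Rightarrow> real" where
  "incidence h i = of_bool (i \<in> fst h) - of_bool (i \<in> snd h)"

lemma sum_incidence:
  fixes h :: "('v::finite) hyperedge"
  shows "(\<Sum>i\<in>UNIV. incidence h i * f i) = (\<Sum>i\<in>fst h. f i) - (\<Sum>i\<in>snd h. f i)"
  by (simp add: incidence_def left_diff_distrib sum_subtractf of_bool_def if_distrib[of "\<lambda>c. c * _"]
      sum.If_cases cong: if_cong)

text \<open>In matrix form, the Laplacian is the inverse degree matrix times the incidence matrix
  times its transpose.\<close>

lemma normalized_laplacian_incidence:
  fixes H :: "('v::finite) hyperedge set"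
  shows "normalized_laplacian H f $ i =
    (\<Sum>h\<in>H. incidence h i * (\<Sum>j\<in>UNIV. incidence h j * f $ j)) / vertex_degree H i"
proof -
  have "(\<Sum>h\<in>H. incidence h i * g h) = (\<Sum>h\<in>{h \<in> H. i \<in> fst h}. g h) - (\<Sum>h\<in>{h \<in> H. i \<in> snd h}. g h)"
    for g
    by (simp add: incidence_def left_diff_distrib sum_subtractf of_bool_def
        if_distrib[of "\<lambda>c. c * _"] sum.inter_filter cong: if_cong)
  then show ?thesis by (simp add: normalized_laplacian_def sum_incidence)
qed

text \<open>Disjointness of inputs and outputs enters here: it makes every entry at a vertex of
  \<open>h\<close> equal to 1 or -1, with square 1.\<close>

lemma sum_incidence_square:
  fixes H :: "('v::finite) hyperedge set"
  assumes "oriented_hypergraph H"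
  shows "(\<Sum>h\<in>H. incidence h i * incidence h i) = vertex_degree H i"
proof -
  have "(\<Sum>h\<in>H. incidence h i * incidence h i) = (\<Sum>h\<in>H. of_bool (i \<in> fst h \<union> snd h))"
    using assms by (intro sum.cong) (fastforce simp: oriented_hypergraph_def incidence_def)+
  then show ?thesis
    by (simp add: vertex_degree_def of_bool_def sum.inter_filter[symmetric])
qed

theorem theorem3:
  fixes H :: "('v::finite) hyperedge set"
    and n m_V :: nat
    and lambda_min lambda_n :: real
  assumes "oriented_hypergraph H"
    and "\<And>i. vertex_degree H i \<noteq> 0"
    and "n = CARD('v)"
    and "m_V = eigenvalue_multiplicity (normalized_laplacian H) 0"
    and "lambda_min = smallest_nonzero_eigenvalue (normalized_laplacian H)"
    and "lambda_n = largest_eigenvalue (normalized_laplacian H)"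
  shows "lambda_min \<le> real n / (real n - real m_V) \<and>
         real n / (real n - real m_V) \<le> lambda_n \<and>
         (lambda_min = real n / (real n - real m_V) \<or> real n / (real n - real m_V) = lambda_n
            \<longleftrightarrow> lambda_min = lambda_n)"
proof -
  \<comment> \<open>\<open>P\<close> scales by the square roots of the degrees, and \<open>S\<close>
    is the Laplacian conjugated by \<open>P\<close>. The map \<open>bd\<close> is the transposed
    incidence matrix after division by \<open>r\<close>.\<close>
  define r where "r i = sqrt (vertex_degree H i)" for i
  have r: "r i \<noteq> 0" "r i * r i = vertex_degree H i" for i
    using assms(2) by (simp_all add: r_def)
  define P :: "real ^ 'v \<Rightarrow> real ^ 'v" where "P f = (\<chi> i. r i * f $ i)" for f
  define bd where "bd f h = (\<Sum>j\<in>UNIV. incidence h j * (f $ j / r j))"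
    for f :: "real ^ 'v" and h
  define S where "S f = (\<chi> i. (\<Sum>h\<in>H. incidence h i * bd f h) / r i)" for f
  have "linear P"
    by (rule linearI) (simp_all add: P_def vec_eq_iff algebra_simps)
  moreover have "inj P"
    using r by (auto intro!: injI simp: P_def vec_eq_iff)
  moreover have "S (P f) = P (normalized_laplacian H f)" for f
    using r by (simp add: vec_eq_iff S_def P_def bd_def normalized_laplacian_incidence
        r(2)[symmetric] del: r(2))
  ultimately have conj: "eigenvalues S = eigenvalues (normalized_laplacian H)"
      "eigenvalue_multiplicity S 0 = eigenvalue_multiplicity (normalized_laplacian H) 0"
    by (rule eigenvalues_conjugate)+
  have bd_linear: "bd (f + g) h = bd f h + bd g h" "bd (c *\<^sub>R f) h = c * bd f h" for f g h c
    by (simp_all add: bd_def algebra_simps sum.distrib add_divide_distrib sum_distrib_left)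
  have "linear S"
    by (rule linearI) (simp_all add: S_def vec_eq_iff bd_linear algebra_simps sum.distrib
        add_divide_distrib sum_distrib_left)
  \<comment> \<open>\<open>S\<close> is the transpose of \<open>bd\<close> composed with
    \<open>bd\<close>, so its form is symmetric and its diagonal entries are sums of
    squares.\<close>
  have form: "f \<bullet> S g = (\<Sum>h\<in>H. bd f h * bd g h)" for f g
  proof -
    have "f \<bullet> S g = (\<Sum>i\<in>UNIV. \<Sum>h\<in>H. incidence h i * (f $ i / r i) * bd g h)"
      by (simp add: inner_vec_def S_def sum_distrib_left sum_divide_distrib mult_ac)
    also have "\<dots> = (\<Sum>h\<in>H. bd f h * bd g h)"
      by (subst sum.swap) (simp add: bd_def sum_distrib_right)
    finally show ?thesis .
  qed
  have bd_axis: "bd (axis i 1) h = incidence h i / r i" for i h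
    by (simp add: bd_def axis_def if_distrib[of "\<lambda>c. c / _"] if_distrib[of "\<lambda>c. _ * c"] cong: if_cong)
  \<comment> \<open>The squared incidences at \<open>i\<close> sum to the degree, which cancels the
    two factors \<open>r i\<close> in the denominator.\<close>
  have diag: "axis i 1 \<bullet> S (axis i 1) = 1" for i
    using r[of i] sum_incidence_square[OF assms(1), of i] assms(2)[of i]
    by (simp add: form bd_axis sum_divide_distrib[symmetric])
  have "(\<Sum>b\<in>Basis. b \<bullet> S b) = (\<Sum>b\<in>(Basis :: (real ^ 'v) set). 1)"
    by (rule sum.cong) (auto simp: Basis_vec_def diag)
  then have tr: "real n = (\<Sum>b\<in>Basis. b \<bullet> S b)" by (simp add: assms(3))
  have "real n > 0" by (simp add: assms(3))
  have "x \<bullet> S y = S x \<bullet> y" for x y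
    by (simp add: form inner_commute[of "S x"] mult.commute)
  from self_adjoint_average_nonzero_eigenvalue[OF \<open>linear S\<close> this tr \<open>real n > 0\<close>]
  show ?thesis
    using assms(3-6) conj by (simp add: smallest_nonzero_eigenvalue_def largest_eigenvalue_def)
qed

end
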